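(* Let $\Gamma$ be a finite loopless graph (multiple edges allowed) and $A$ an abelian group of prime power order $p^n$. Suppose $\Gamma_1,\dots,\Gamma_s$ ($s\ge 2$) are subgraphs of $\Gamma$ with $\Gamma=\bigcup_{i=1}^s\Gamma_i$. If each $\Gamma_i$ admits a nowhere-zero $A$-flow, and for each $\ell\in\{2,\dots,s\}$ the graphs $\bigcup_{i=1}^{\ell-1}\Gamma_i$ and $\Gamma_\ell$ have at most $p^n-2$ common edges, then $\Gamma$ admits a nowhere-zero $A$-flow.
   Context: An orientation $\mathcal D$ of a graph assigns each edge one of its two directions; $\mathcal D^+(v)$ (resp. $\mathcal D^-(v)$) is the set of edges with tail (resp. head) at $v$. For an abelian group $A$ and a map $\varphi:E(\Gamma)\to A$, the pair $(\mathcal D,\varphi)$ is an $A$-flow if $\sum_{e\in\mathcal D^+(v)}\varphi(e)=\sum_{e\in\mathcal D^-(v)}\varphi(e)$ for every vertex $v$; it is nowhere-zero if $\varphi(e)\ne0$ for every edge $e$. A graph admits a nowhere-zero $A$-flow if such a pair exists for some orientation (equivalently, for every orientation). *)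

theory Defs
  imports "HOL-Algebra.Algebra" "Graph_Theory.Digraph"
begin

record ('v, 'e) mgraph =
  mverts :: "'v set"
  medges :: "'e set"
  ends   :: "'e \<Rightarrow> 'v set"

text \<open>
  Every edge has exactly two distinct ends, so there are no loops; distinct edges may have
  the same ends. The values of \<^const>\<open>ends\<close> outside \<^const>\<open>medges\<close> are irrelevant.
\<close>

definition loopless_mgraph :: "('v, 'e) mgraph \<Rightarrow> bool" where
  "loopless_mgraph G \<longleftrightarrow> (\<forall>e\<in>medges G. ends G e \<subseteq> mverts G \<and> card (ends G e) = 2)"

definition finite_mgraph :: "('v, 'e) mgraph \<Rightarrow> bool" where
  "finite_mgraph G \<longleftrightarrow> finite (mverts G) \<and> finite (medges G)"

definition is_subgraph :: "('v, 'e) mgraph \<Rightarrow> ('v, 'e) mgraph \<Rightarrow> bool" where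
  "is_subgraph H G \<longleftrightarrow> loopless_mgraph H \<and> mverts H \<subseteq> mverts G \<and> medges H \<subseteq> medges G \<and>
     (\<forall>e\<in>medges H. ends H e = ends G e)"

text \<open>
  The union of a family of subgraphs of a common graph \<open>G\<close>, from which the ends are inherited.
\<close>

definition subgraph_Union ::
  "('v, 'e) mgraph \<Rightarrow> 'i set \<Rightarrow> ('i \<Rightarrow> ('v, 'e) mgraph) \<Rightarrow> ('v, 'e) mgraph" where
  "subgraph_Union G I H =
     \<lparr>mverts = (\<Union>i\<in>I. mverts (H i)), medges = (\<Union>i\<in>I. medges (H i)), ends = ends G\<rparr>"

definition orientation :: "('v, 'e) mgraph \<Rightarrow> ('v, 'e) pre_digraph \<Rightarrow> bool" where
  "orientation G D \<longleftrightarrow> verts D = mverts G \<and> arcs D = medges G \<and>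
     (\<forall>e\<in>medges G. {tail D e, head D e} = ends G e)"

text \<open>
  Abelian groups are written multiplicatively, as in HOL-Algebra: the sums in the conservation
  law are rendered by \<^const>\<open>finprod\<close>, and the zero of the group is its neutral element.
\<close>

definition is_flow ::
  "('a, 'm) monoid_scheme \<Rightarrow> ('v, 'e) mgraph \<Rightarrow> ('v, 'e) pre_digraph \<Rightarrow> ('e \<Rightarrow> 'a) \<Rightarrow> bool" where
  "is_flow A G D \<phi> \<longleftrightarrow> orientation G D \<and> \<phi> \<in> medges G \<rightarrow> carrier A \<and>
     (\<forall>v\<in>mverts G. finprod A \<phi> (out_arcs D v) = finprod A \<phi> (in_arcs D v))"

definition nowhere_zero :: "('a, 'm) monoid_scheme \<Rightarrow> ('v, 'e) mgraph \<Rightarrow> ('e \<Rightarrow> 'a) \<Rightarrow> bool" where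
  "nowhere_zero A G \<phi> \<longleftrightarrow> (\<forall>e\<in>medges G. \<phi> e \<noteq> \<one>\<^bsub>A\<^esub>)"

definition admits_nowhere_zero_flow ::
  "('a, 'm) monoid_scheme \<Rightarrow> ('v, 'e) mgraph \<Rightarrow> bool" where
  "admits_nowhere_zero_flow A G \<longleftrightarrow> (\<exists>D \<phi>. is_flow A G D \<phi> \<and> nowhere_zero A G \<phi>)"

end

theory Submission
  imports Defs
begin

text \<open>
  By Tutte's theorem the number of nowhere-zero flows depends only on the order of the group, so
  \<open>A\<close> may be replaced by the elementary abelian group of order \<open>q = p ^ n\<close>, whose automorphism
  group is transitive on the non-neutral elements. Given nowhere-zero flows \<open>f\<close> and \<open>g\<close> on two
  subgraphs sharing fewer than \<open>q - 1\<close> edges, some automorphism \<open>T\<close> satisfies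
  \<open>T (g e) \<noteq> - f e\<close> on all common edges, and then \<open>f + T g\<close> is nowhere zero on the union.
\<close>

section \<open>Edgewise conservation and sets of nowhere-zero flows\<close>

text \<open>
  Conservation is phrased edgewise, as triviality of a product over the fixed index set \<open>E\<close>:
  contraction and reorientation then become pointwise identities.
\<close>

definition net :: "('a, 'm) monoid_scheme \<Rightarrow> ('e \<Rightarrow> 'v) \<Rightarrow> ('e \<Rightarrow> 'v) \<Rightarrow> ('e \<Rightarrow> 'a) \<Rightarrow> 'v \<Rightarrow> 'e \<Rightarrow> 'a" where
  "net G t h \<phi> v e =
     (if t e = v then \<phi> e else \<one>\<^bsub>G\<^esub>) \<otimes>\<^bsub>G\<^esub> inv\<^bsub>G\<^esub> (if h e = v then \<phi> e else \<one>\<^bsub>G\<^esub>)"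

text \<open>The quantifier runs over the whole vertex type, with trivial products at vertices that
  meet no edge of \<open>E\<close>. No vertex set has to be updated: after a contraction the
  absorbed vertex simply stays behind as an isolated one.\<close>

definition conserved :: "('a, 'm) monoid_scheme \<Rightarrow> ('e \<Rightarrow> 'v) \<Rightarrow> ('e \<Rightarrow> 'v) \<Rightarrow> 'e set \<Rightarrow> ('e \<Rightarrow> 'a) \<Rightarrow> bool" where
  "conserved G t h E \<phi> \<longleftrightarrow> (\<forall>v. finprod G (net G t h \<phi> v) E = \<one>\<^bsub>G\<^esub>)"

text \<open>Extensional functions, fixed outside \<open>E\<close>, are used so that over a finite
  group there are finitely many flows and counting them makes sense.\<close>

definition nz_flows :: "('a, 'm) monoid_scheme \<Rightarrow> ('e \<Rightarrow> 'v) \<Rightarrow> ('e \<Rightarrow> 'v) \<Rightarrow> 'e set \<Rightarrow> ('e \<Rightarrow> 'a) set" where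
  "nz_flows G t h E = {\<phi> \<in> E \<rightarrow>\<^sub>E carrier G - {\<one>\<^bsub>G\<^esub>}. conserved G t h E \<phi>}"

context comm_group
begin

lemma net_closed [simp]: "\<phi> e \<in> carrier G \<Longrightarrow> net G t h \<phi> v e \<in> carrier G"
  by (simp add: net_def)

lemma net_funcset: "\<phi> \<in> E \<rightarrow> carrier G \<Longrightarrow> net G t h \<phi> v \<in> E \<rightarrow> carrier G"
  by (auto simp: Pi_iff)

lemma finprod_net_cong:
  assumes "\<And>e. e \<in> E \<Longrightarrow> \<phi> e = \<psi> e" "\<psi> \<in> E \<rightarrow> carrier G"
  shows "finprod G (net G t h \<phi> v) E = finprod G (net G t h \<psi> v) E"
  using assms by (intro finprod_cong') (auto simp: net_def Pi_iff)

lemma conserved_cong: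
  assumes "\<And>e. e \<in> E \<Longrightarrow> \<phi> e = \<psi> e" "\<psi> \<in> E \<rightarrow> carrier G"
  shows "conserved G t h E \<phi> \<longleftrightarrow> conserved G t h E \<psi>"
  unfolding conserved_def by (subst finprod_net_cong[OF assms]) simp_all

lemma finite_nz_flows: "finite E \<Longrightarrow> finite (carrier G) \<Longrightarrow> finite (nz_flows G t h E)"
  unfolding nz_flows_def by (rule finite_subset[OF _ finite_PiE[of E "\<lambda>_. carrier G - {\<one>}"]]) auto

lemma nz_flows_empty: "nz_flows G t h {} = {\<lambda>_. undefined}"
  by (auto simp: nz_flows_def conserved_def)

section \<open>Deletion and contraction\<close>

text \<open>At its only vertex a loop contributes its value times the inverse of that value. Its
  value is therefore a free choice among the non-neutral elements.\<close>

lemma card_nz_flows_loop: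
  assumes "finite E" "e \<notin> E" "t e = h e" "finite (carrier G)"
  shows "card (nz_flows G t h (insert e E)) = (order G - 1) * card (nz_flows G t h E)"
proof -
  have *: "conserved G t h (insert e E) (f(e := x)) \<longleftrightarrow> conserved G t h E f"
    if "x \<in> carrier G" "f \<in> E \<rightarrow> carrier G" for x f
  proof -
    have "finprod G (net G t h (f(e := x)) v) (insert e E) = finprod G (net G t h f v) E" for v
    proof -
      have "finprod G (net G t h (f(e := x)) v) E = finprod G (net G t h f v) E"
        using assms that by (intro finprod_net_cong) auto
      moreover have "net G t h (f(e := x)) v e = \<one>"
        using assms that by (simp add: net_def)
      moreover have "net G t h (f(e := x)) v \<in> E \<rightarrow> carrier G"
        using assms that by (intro net_funcset) auto
      moreover have "finprod G (net G t h f v) E \<in> carrier G"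
        using that by (intro finprod_closed net_funcset)
      ultimately show ?thesis using assms by simp
    qed
    then show ?thesis by (simp add: conserved_def)
  qed
  have "nz_flows G t h (insert e E) =
      (\<lambda>(y, g). g(e := y)) ` ((carrier G - {\<one>}) \<times> nz_flows G t h E)"
    (is "?L = ?R")
  proof
    show "?L \<subseteq> ?R"
    proof
      fix f assume f: "f \<in> ?L"
      then have "f \<in> insert e E \<rightarrow>\<^sub>E carrier G - {\<one>}" by (simp add: nz_flows_def)
      then obtain y g where yg: "y \<in> carrier G - {\<one>}" "g \<in> E \<rightarrow>\<^sub>E carrier G - {\<one>}" "f = g(e := y)"
        by (auto simp: PiE_insert_eq)
      with f *[of y g] have "g \<in> nz_flows G t h E"
        by (auto simp: nz_flows_def PiE_iff Pi_iff)
      with yg show "f \<in> ?R" by auto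
    qed
    show "?R \<subseteq> ?L"
    proof -
      have "g(e := y) \<in> ?L" if y: "y \<in> carrier G" "y \<noteq> \<one>" and g: "g \<in> nz_flows G t h E" for y g
      proof -
        have "g(e := y) \<in> insert e E \<rightarrow>\<^sub>E carrier G - {\<one>}"
          unfolding PiE_insert_eq using y g by (auto simp: nz_flows_def)
        then show ?thesis
          using *[of y g] y g by (auto simp: nz_flows_def PiE_iff Pi_iff)
      qed
      then show ?thesis by auto
    qed
  qed
  moreover have "inj_on (\<lambda>(y, g). g(e := y)) ((carrier G - {\<one>}) \<times> nz_flows G t h E)"
    by (rule inj_on_subset[OF inj_combinator[of e E "\<lambda>_. carrier G - {\<one>}"]])
      (use assms in \<open>auto simp: nz_flows_def\<close>)
  ultimately show ?thesis
    using assms by (simp add: card_image card_cartesian_product order_def)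
qed

text \<open>A flow of the contracted graph determines what \<open>e\<close> would have to carry to
  restore conservation at both of its ends. If this value is neutral, it is already a flow with
  \<open>e\<close> deleted; otherwise it extends uniquely to a nowhere-zero flow with
  \<open>e\<close> present.\<close>

lemma card_nz_flows_contract:
  assumes "finite E" "e \<notin> E" "t e \<noteq> h e" "finite (carrier G)"
  defines "\<pi> \<equiv> \<lambda>x. if x = h e then t e else x"
  shows "card (nz_flows G (\<pi> \<circ> t) (\<pi> \<circ> h) E) =
    card (nz_flows G t h (insert e E)) + card (nz_flows G t h E)"
proof -
  define a b where "a = t e" and "b = h e"
  have ab: "a \<noteq> b" using assms by (simp add: a_def b_def)
  define S where "S f v = finprod G (net G t h f v) E" for f v
  have S_closed: "S f v \<in> carrier G" if "f \<in> E \<rightarrow> carrier G" for f v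
    unfolding S_def using that by (intro finprod_closed net_funcset)
  have contracted: "finprod G (net G (\<pi> \<circ> t) (\<pi> \<circ> h) f v) E =
      (if v = a then S f a \<otimes> S f b else if v = b then \<one> else S f v)"
    if f: "f \<in> E \<rightarrow> carrier G" for f v
  proof -
    consider "v = a" | "v = b" | "v \<noteq> a" "v \<noteq> b" by blast
    then show ?thesis
    proof cases
      case 1
      \<comment> \<open>An edge joining \<open>a\<close> and \<open>b\<close> contributes a value to
        one factor on the right and its inverse to the other; contracted, it is a loop at
        \<open>a\<close> and contributes nothing. Any other edge contributes to at most one
        factor.\<close>
      have "net G (\<pi> \<circ> t) (\<pi> \<circ> h) f a x = net G t h f a x \<otimes> net G t h f b x" if "x \<in> E" for x
      proof -
        have "f x \<in> carrier G" using that f by auto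
        then show ?thesis
          using ab by (auto simp: net_def \<pi>_def a_def[symmetric] b_def[symmetric] r_inv l_inv m_comm)
      qed
      then have "finprod G (net G (\<pi> \<circ> t) (\<pi> \<circ> h) f a) E =
          finprod G (\<lambda>x. net G t h f a x \<otimes> net G t h f b x) E"
        using f by (intro finprod_cong') (auto simp: Pi_iff)
      then show ?thesis
        using 1 f unfolding S_def by (simp add: finprod_multf net_funcset)
    next
      case 2
      have "finprod G (net G (\<pi> \<circ> t) (\<pi> \<circ> h) f b) E = \<one>"
        using f ab by (intro finprod_one_eqI)
          (auto simp: net_def \<pi>_def a_def[symmetric] b_def[symmetric])
      then show ?thesis using 2 ab by simp
    next
      case 3
      have "finprod G (net G (\<pi> \<circ> t) (\<pi> \<circ> h) f v) E = S f v"
        unfolding S_def using f 3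
        by (intro finprod_cong')
          (auto simp: net_def \<pi>_def a_def[symmetric] b_def[symmetric] Pi_iff)
      then show ?thesis using 3 by simp
    qed
  qed
  have contracted_iff: "conserved G (\<pi> \<circ> t) (\<pi> \<circ> h) E f \<longleftrightarrow>
      S f a \<otimes> S f b = \<one> \<and> (\<forall>v. v \<noteq> a \<longrightarrow> v \<noteq> b \<longrightarrow> S f v = \<one>)"
    if "f \<in> E \<rightarrow> carrier G" for f
    unfolding conserved_def using contracted[OF that] ab by auto
  have inserted_iff: "conserved G t h (insert e E) g \<longleftrightarrow>
      g e \<otimes> S g a = \<one> \<and> inv (g e) \<otimes> S g b = \<one> \<and> (\<forall>v. v \<noteq> a \<longrightarrow> v \<noteq> b \<longrightarrow> S g v = \<one>)"
    if g: "g \<in> insert e E \<rightarrow> carrier G" for g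
  proof -
    have "finprod G (net G t h g v) (insert e E) = net G t h g v e \<otimes> S g v" for v
      unfolding S_def using g assms by (subst finprod_insert) (auto simp: Pi_iff)
    moreover have "net G t h g v e = (if v = a then g e else if v = b then inv (g e) else \<one>)" for v
      using g ab by (auto simp: net_def a_def b_def)
    moreover have "S g v \<in> carrier G" for v using g by (intro S_closed) auto
    ultimately show ?thesis
      unfolding conserved_def using ab by (auto split: if_splits)
  qed
  have S_cong: "S f v = S g v" if "\<And>x. x \<in> E \<Longrightarrow> f x = g x" "g \<in> E \<rightarrow> carrier G" for f g v
    unfolding S_def using that by (rule finprod_net_cong)
  let ?N' = "nz_flows G (\<pi> \<circ> t) (\<pi> \<circ> h) E" and ?N = "nz_flows G t h E"
    and ?M = "nz_flows G t h (insert e E)" and ?r = "\<lambda>f. restrict f E"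
  \<comment> \<open>Conservation at \<open>a\<close> and \<open>b\<close> forces the value on
    \<open>e\<close>, and \<open>S\<close> sees only the edges in \<open>E\<close>. Hence
    restriction to \<open>E\<close> is injective on \<open>?M\<close>, and
    \<open>S f b = f e \<noteq> \<one>\<close> separates its image from \<open>?N\<close>, where
    \<open>S\<close> is trivial everywhere.\<close>
  have M_D: "f \<in> insert e E \<rightarrow> carrier G" "f e \<noteq> \<one>" "f e \<in> carrier G" "f e = inv (S f a)"
    "S f b = f e" "S (?r f) = S f" "\<forall>v. v \<noteq> a \<longrightarrow> v \<noteq> b \<longrightarrow> S f v = \<one>"
    if "f \<in> ?M" for f
  proof -
    show f: "f \<in> insert e E \<rightarrow> carrier G" and "f e \<noteq> \<one>" and fe: "f e \<in> carrier G"
      using that by (auto simp: nz_flows_def)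
    then have fE: "f \<in> E \<rightarrow> carrier G" by auto
    have *: "f e \<otimes> S f a = \<one> \<and> inv (f e) \<otimes> S f b = \<one> \<and> (\<forall>v. v \<noteq> a \<longrightarrow> v \<noteq> b \<longrightarrow> S f v = \<one>)"
      using that inserted_iff[OF f] by (simp add: nz_flows_def)
    then show "f e = inv (S f a)"
      using fe S_closed[OF fE] by (metis inv_equality inv_inv)
    show "S f b = f e"
      using * fe S_closed[OF fE] by (metis inv_closed inv_inv inv_unique' inv_equality)
    show "S (?r f) = S f" using fE by (intro ext S_cong) auto
    show "\<forall>v. v \<noteq> a \<longrightarrow> v \<noteq> b \<longrightarrow> S f v = \<one>" using * by simp
  qed
  have "inj_on ?r ?M"
  proof (rule inj_onI)
    fix f g assume fg: "f \<in> ?M" "g \<in> ?M" and eq: "?r f = ?r g"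
    have "S f = S g" using M_D(6)[OF fg(1)] M_D(6)[OF fg(2)] eq by simp
    then have "f e = g e" using M_D(4)[OF fg(1)] M_D(4)[OF fg(2)] by simp
    moreover have "f x = g x" if "x \<in> E" for x using eq that by (metis restrict_apply')
    ultimately show "f = g"
      using fg by (intro PiE_ext[of f "insert e E" "\<lambda>_. carrier G - {\<one>}" g]) (auto simp: nz_flows_def)
  qed
  moreover have "?r ` ?M \<inter> ?N = {}"
  proof -
    have "?r f \<notin> ?N" if "f \<in> ?M" for f
    proof
      assume "?r f \<in> ?N"
      then have "S (?r f) b = \<one>" by (simp add: nz_flows_def conserved_def S_def)
      then show False using M_D[OF that] by simp
    qed
    then show ?thesis by blast
  qed
  moreover have "?N' = ?r ` ?M \<union> ?N"
  proof
    show "?N' \<subseteq> ?r ` ?M \<union> ?N"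
    proof
      fix f assume "f \<in> ?N'"
      then have f: "f \<in> E \<rightarrow>\<^sub>E carrier G - {\<one>}" and c: "conserved G (\<pi> \<circ> t) (\<pi> \<circ> h) E f"
        by (auto simp: nz_flows_def)
      from f have fE: "f \<in> E \<rightarrow> carrier G" by auto
      note cl = S_closed[OF fE]
      have c': "S f a \<otimes> S f b = \<one>" "\<And>v. v \<noteq> a \<Longrightarrow> v \<noteq> b \<Longrightarrow> S f v = \<one>"
        using c contracted_iff[OF fE] by auto
      \<comment> \<open>Conservation at the head \<open>b\<close> requires \<open>e\<close> to carry
        exactly \<open>S f b\<close>, so this element decides between deletion and
        extension.\<close>
      show "f \<in> ?r ` ?M \<union> ?N"
      proof (cases "S f b = \<one>")
        case True
        with c' cl have "S f v = \<one>" for v by (metis r_one)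
        then show ?thesis using f by (simp add: nz_flows_def conserved_def S_def)
      next
        case False
        define g where "g = f(e := S f b)"
        have g: "g \<in> insert e E \<rightarrow>\<^sub>E carrier G - {\<one>}"
          unfolding g_def PiE_insert_eq using f False cl by auto
        then have gE: "g \<in> insert e E \<rightarrow> carrier G" by auto
        have Sg: "S g v = S f v" for v
          using fE assms by (intro S_cong) (auto simp: g_def)
        have "conserved G t h (insert e E) g"
          using inserted_iff[OF gE] Sg c' cl by (simp add: g_def m_comm)
        then have "g \<in> ?M" using g by (simp add: nz_flows_def)
        moreover have "f = ?r g"
          using f assms by (intro ext) (auto simp: g_def PiE_iff extensional_def)
        ultimately show ?thesis by blast
      qed
    qed
    show "?r ` ?M \<union> ?N \<subseteq> ?N'"
    proof (intro Un_least image_subsetI subsetI)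
      fix f assume f: "f \<in> ?M"
      note D = M_D[OF f]
      have rE: "?r f \<in> E \<rightarrow> carrier G" using D(1) by auto
      have "S f a \<in> carrier G" using D(1) by (intro S_closed) auto
      then have "S f a \<otimes> S f b = \<one>" using D(4,5) by simp
      then have "conserved G (\<pi> \<circ> t) (\<pi> \<circ> h) E (?r f)"
        using contracted_iff[OF rE] D(6,7) by simp
      moreover have "?r f \<in> E \<rightarrow>\<^sub>E carrier G - {\<one>}"
        using f by (auto simp: nz_flows_def)
      ultimately show "?r f \<in> ?N'" by (simp add: nz_flows_def)
    next
      fix f assume f: "f \<in> ?N"
      then have "f \<in> E \<rightarrow> carrier G" by (auto simp: nz_flows_def)
      then show "f \<in> ?N'"
        using f contracted_iff[of f] by (auto simp: nz_flows_def conserved_def S_def)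
    qed
  qed
  ultimately show ?thesis
    using assms by (simp add: card_Un_disjoint finite_nz_flows card_image)
qed

end

text \<open>
  Tutte's theorem, by deletion and contraction: the edge \<open>e\<close> is contracted by composing the
  tail and head maps with the identification of its two ends, so the vertex type never changes
  (other edges may become loops).
\<close>

lemma card_nz_flows_eq:
  fixes A :: "('a, 'm) monoid_scheme" and B :: "('b, 'k) monoid_scheme"
  assumes "comm_group A" "comm_group B" "finite (carrier A)" "finite (carrier B)"
    and "order A = order B" "finite E"
  shows "card (nz_flows A t h E) = card (nz_flows B t h E)"
  using \<open>finite E\<close>
proof (induction E arbitrary: t h)
  case empty
  then show ?case
    using assms by (simp add: comm_group.nz_flows_empty)
next
  case (insert e E)
  interpret A: comm_group A by fact
  interpret B: comm_group B by fact
  show ?case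
  proof (cases "t e = h e")
    case True
    then show ?thesis
      using insert assms by (simp add: A.card_nz_flows_loop B.card_nz_flows_loop)
  next
    case False
    \<comment> \<open>The induction hypothesis, general in \<open>t\<close> and \<open>h\<close>,
      gives equal counts for the contracted and the deleted graph; the count with \<open>e\<close>
      present is their difference.\<close>
    show ?thesis
      using A.card_nz_flows_contract[of E e t h] insert.hyps False assms(3,4)
        B.card_nz_flows_contract[of E e t h] insert.IH
      by (metis add_right_cancel)
  qed
qed

section \<open>Operations on flows\<close>

context comm_group
begin

lemma conserved_hom:
  assumes T: "T \<in> hom G G" and "\<phi> \<in> E \<rightarrow> carrier G" "conserved G t h E \<phi>" "finite E"
  shows "conserved G t h E (\<lambda>e. T (\<phi> e))"
proof -
  interpret T: group_hom G G T
    by (simp add: T group_hom_axioms_def group_hom_def is_group)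
  have "finprod G (net G t h (\<lambda>e. T (\<phi> e)) v) E = T (finprod G (net G t h \<phi> v) E)" for v
    using \<open>finite E\<close> \<open>\<phi> \<in> E \<rightarrow> carrier G\<close>
  proof (induction E)
    case (insert e F)
    have "net G t h (\<lambda>e. T (\<phi> e)) v e = T (net G t h \<phi> v e)"
      using insert.prems by (auto simp: net_def)
    moreover have "net G t h (\<lambda>e. T (\<phi> e)) v \<in> F \<rightarrow> carrier G"
      using insert.prems by (intro net_funcset) (auto intro: T.hom_closed simp: Pi_iff)
    moreover have "net G t h \<phi> v \<in> F \<rightarrow> carrier G"
      using insert.prems by (intro net_funcset) auto
    ultimately show ?case using insert by simp
  qed simp
  then show ?thesis using assms by (simp add: conserved_def)
qed

lemma conserved_mult:
  assumes "\<phi> \<in> E \<rightarrow> carrier G" "\<psi> \<in> E \<rightarrow> carrier G"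
    and "conserved G t h E \<phi>" "conserved G t h E \<psi>"
  shows "conserved G t h E (\<lambda>e. \<phi> e \<otimes> \<psi> e)"
proof -
  have "finprod G (net G t h (\<lambda>e. \<phi> e \<otimes> \<psi> e) v) E =
      finprod G (\<lambda>e. net G t h \<phi> v e \<otimes> net G t h \<psi> v e) E" for v
  proof (rule finprod_cong')
    fix e assume "e \<in> E"
    then have "\<phi> e \<in> carrier G" "\<psi> e \<in> carrier G" using assms by auto
    then show "net G t h (\<lambda>e. \<phi> e \<otimes> \<psi> e) v e = net G t h \<phi> v e \<otimes> net G t h \<psi> v e"
      by (simp add: net_def inv_mult m_ac)
  qed (use assms in \<open>auto simp: Pi_iff\<close>)
  then show ?thesis
    using assms by (simp add: conserved_def finprod_multf net_funcset)
qed

lemma conserved_extend: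
  assumes "E \<subseteq> F" "finite F" "\<phi> \<in> E \<rightarrow> carrier G" "conserved G t h E \<phi>"
  shows "conserved G t h F (\<lambda>e. if e \<in> E then \<phi> e else \<one>)"
proof -
  have "finprod G (net G t h \<phi> v) E = finprod G (net G t h (\<lambda>e. if e \<in> E then \<phi> e else \<one>) v) F" for v
    using assms by (intro finprod_mono_neutral_cong_left net_funcset) (auto simp: net_def)
  then show ?thesis using assms by (simp add: conserved_def)
qed

text \<open>Reversing an edge and inverting its value leaves \<open>net\<close> unchanged at every
  vertex.\<close>

lemma conserved_reorient:
  assumes "\<phi> \<in> E \<rightarrow> carrier G" "conserved G t h E \<phi>"
    and "\<And>e. e \<in> E \<Longrightarrow> {t' e, h' e} = {t e, h e}"
  shows "conserved G t' h' E (\<lambda>e. if t' e = t e then \<phi> e else inv (\<phi> e))"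
proof -
  have "finprod G (net G t' h' (\<lambda>e. if t' e = t e then \<phi> e else inv (\<phi> e)) v) E =
      finprod G (net G t h \<phi> v) E" for v
  proof (rule finprod_cong')
    fix e assume e: "e \<in> E"
    then have "\<phi> e \<in> carrier G" using assms by auto
    \<comment> \<open>Loops are put under the first case. In the second the ends differ, so the test
      \<open>t' e = t e\<close> fails and the value is inverted, as it should be.\<close>
    moreover have "t' e = t e \<and> h' e = h e \<or> t' e = h e \<and> h' e = t e \<and> t e \<noteq> h e"
      using assms(3)[OF e] by (metis doubleton_eq_iff)
    ultimately show "net G t' h' (\<lambda>e. if t' e = t e then \<phi> e else inv (\<phi> e)) v e = net G t h \<phi> v e"
      by (elim disjE conjE) (simp_all add: net_def)
  qed (use assms in \<open>auto simp: Pi_iff\<close>)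
  then show ?thesis using assms(2) by (simp add: conserved_def)
qed

section \<open>Comparison with flows on graphs\<close>

text \<open>Links the edgewise form to the balance in \<open>is_flow\<close>: the product over
  outgoing edges is the net product times the product over incoming edges, and the latter
  cancels.\<close>

lemma conserved_iff_out_eq_in:
  assumes "finite E" "\<phi> \<in> E \<rightarrow> carrier G"
  shows "conserved G t h E \<phi> \<longleftrightarrow>
    (\<forall>v. finprod G \<phi> {e \<in> E. t e = v} = finprod G \<phi> {e \<in> E. h e = v})"
proof -
  let ?o = "\<lambda>v e. if t e = v then \<phi> e else \<one>" and ?i = "\<lambda>v e. if h e = v then \<phi> e else \<one>"
  have "finprod G (net G t h \<phi> v) E = \<one> \<longleftrightarrow>
      finprod G \<phi> {e \<in> E. t e = v} = finprod G \<phi> {e \<in> E. h e = v}" for v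
  proof -
    have i: "?i v \<in> E \<rightarrow> carrier G" using assms by auto
    have "finprod G (?o v) E = finprod G (\<lambda>e. net G t h \<phi> v e \<otimes> ?i v e) E"
      using assms by (intro finprod_cong') (auto simp: net_def Pi_iff m_assoc)
    also have "\<dots> = finprod G (net G t h \<phi> v) E \<otimes> finprod G (?i v) E"
      using assms i by (intro finprod_multf net_funcset)
    finally have *: "finprod G (?o v) E = finprod G (net G t h \<phi> v) E \<otimes> finprod G (?i v) E" .
    have "finprod G \<phi> {e \<in> E. t e = v} = finprod G (?o v) E"
      using assms by (intro finprod_mono_neutral_cong_left) auto
    moreover have "finprod G \<phi> {e \<in> E. h e = v} = finprod G (?i v) E"
      using assms by (intro finprod_mono_neutral_cong_left) auto
    moreover have "finprod G (net G t h \<phi> v) E \<in> carrier G" "finprod G (?i v) E \<in> carrier G"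
      using assms i by (auto intro!: finprod_closed net_funcset)
    ultimately show ?thesis using * by (simp only: r_cancel_one)
  qed
  then show ?thesis by (simp add: conserved_def)
qed

text \<open>The existence of a flow does not depend on the orientation, so a single choice of
  \<open>t\<close> and \<open>h\<close> can serve for a graph and all its subgraphs at once.\<close>

lemma admits_nowhere_zero_flow_iff:
  assumes "loopless_mgraph \<Gamma>" "finite (medges \<Gamma>)"
    and ends: "\<And>e. e \<in> medges \<Gamma> \<Longrightarrow> {t e, h e} = ends \<Gamma> e"
  shows "admits_nowhere_zero_flow G \<Gamma> \<longleftrightarrow> nz_flows G t h (medges \<Gamma>) \<noteq> {}"
proof
  assume "admits_nowhere_zero_flow G \<Gamma>"
  then obtain D \<phi> where o: "orientation \<Gamma> D" and \<phi>: "\<phi> \<in> medges \<Gamma> \<rightarrow> carrier G"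
    and cons: "\<forall>v\<in>mverts \<Gamma>. finprod G \<phi> (out_arcs D v) = finprod G \<phi> (in_arcs D v)"
    and nz: "\<forall>e\<in>medges \<Gamma>. \<phi> e \<noteq> \<one>"
    by (auto simp: admits_nowhere_zero_flow_def is_flow_def nowhere_zero_def)
  have arcs: "out_arcs D v = {e \<in> medges \<Gamma>. tail D e = v}" "in_arcs D v = {e \<in> medges \<Gamma>. head D e = v}" for v
    using o by (auto simp: orientation_def out_arcs_def in_arcs_def)
  have "finprod G \<phi> {e \<in> medges \<Gamma>. tail D e = v} = finprod G \<phi> {e \<in> medges \<Gamma>. head D e = v}" for v
  \<comment> \<open>\<open>is_flow\<close> speaks only of vertices of the graph,
    \<open>conserved\<close> of the whole type; elsewhere both arc sets are empty.\<close>
  proof (cases "v \<in> mverts \<Gamma>")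
    case False
    have "tail D e \<in> mverts \<Gamma> \<and> head D e \<in> mverts \<Gamma>" if "e \<in> medges \<Gamma>" for e
      using o assms(1) that unfolding orientation_def loopless_mgraph_def by blast
    with False have "{e \<in> medges \<Gamma>. tail D e = v} = {}" "{e \<in> medges \<Gamma>. head D e = v} = {}" by auto
    then show ?thesis by (simp only: finprod_empty)
  qed (use cons arcs in auto)
  then have "conserved G (tail D) (head D) (medges \<Gamma>) \<phi>"
    using assms \<phi> by (simp add: conserved_iff_out_eq_in)
  then have "conserved G t h (medges \<Gamma>) (\<lambda>e. if t e = tail D e then \<phi> e else inv (\<phi> e))"
    using o ends \<phi> by (intro conserved_reorient) (auto simp: orientation_def)
  then have "conserved G t h (medges \<Gamma>) (\<lambda>e\<in>medges \<Gamma>. if t e = tail D e then \<phi> e else inv (\<phi> e))"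
    using \<phi> by (subst conserved_cong[where \<psi> = "\<lambda>e. if t e = tail D e then \<phi> e else inv (\<phi> e)"])
      (auto simp: Pi_iff)
  moreover have "(\<lambda>e\<in>medges \<Gamma>. if t e = tail D e then \<phi> e else inv (\<phi> e)) \<in>
      medges \<Gamma> \<rightarrow>\<^sub>E carrier G - {\<one>}"
    using \<phi> nz by (auto simp: inv_eq_1_iff Pi_iff)
  ultimately show "nz_flows G t h (medges \<Gamma>) \<noteq> {}" unfolding nz_flows_def by blast
next
  assume "nz_flows G t h (medges \<Gamma>) \<noteq> {}"
  then obtain \<phi> where \<phi>: "\<phi> \<in> medges \<Gamma> \<rightarrow>\<^sub>E carrier G - {\<one>}" and c: "conserved G t h (medges \<Gamma>) \<phi>"
    by (auto simp: nz_flows_def)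
  let ?D = "\<lparr>verts = mverts \<Gamma>, arcs = medges \<Gamma>, tail = t, head = h\<rparr>"
  have \<phi>': "\<phi> \<in> medges \<Gamma> \<rightarrow> carrier G" using \<phi> by auto
  have "is_flow G \<Gamma> ?D \<phi>"
    using ends \<phi>' c conserved_iff_out_eq_in[OF assms(2) \<phi>', of t h]
    by (auto simp: is_flow_def orientation_def out_arcs_def in_arcs_def)
  moreover have "nowhere_zero G \<Gamma> \<phi>" using \<phi> by (auto simp: nowhere_zero_def)
  ultimately show "admits_nowhere_zero_flow G \<Gamma>" unfolding admits_nowhere_zero_flow_def by blast
qed

end

section \<open>Automorphisms and the merging of two flows\<close>

text \<open>Composition with \<open>U\<close> after \<open>T\<close> is an injection from the first
  set into the second.\<close>

lemma (in group) card_auto_mapping_le: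
  assumes "finite (carrier G)" "U \<in> auto G" "U y = z" "x \<in> carrier G"
  shows "card {T \<in> auto G. T x = y} \<le> card {T \<in> auto G. T x = z}"
proof (rule card_inj_on_le)
  let ?f = "compose (carrier G) U"
  have U: "U \<in> hom G G" "inj_on U (carrier G)" "U \<in> Bij (carrier G)"
    using assms by (auto simp: auto_def Bij_def bij_betw_def)
  show "inj_on ?f {T \<in> auto G. T x = y}"
  proof (rule inj_onI)
    fix T T' assume T: "T \<in> {T \<in> auto G. T x = y}" "T' \<in> {T \<in> auto G. T x = y}" and eq: "?f T = ?f T'"
    show "T = T'"
    proof (rule extensionalityI)
      show "T \<in> extensional (carrier G)" "T' \<in> extensional (carrier G)"
        using T by (auto simp: auto_def Bij_def)
      fix w assume w: "w \<in> carrier G"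
      then have "U (T w) = U (T' w)" using fun_cong[OF eq, of w] by (simp add: compose_eq)
      moreover have "T w \<in> carrier G" "T' w \<in> carrier G"
        using T w by (auto simp: auto_def hom_def)
      ultimately show "T w = T' w" using U(2) by (auto dest: inj_onD)
    qed
  qed
  show "?f ` {T \<in> auto G. T x = y} \<subseteq> {T \<in> auto G. T x = z}"
    using assms U by (auto simp: auto_def compose_Bij hom_compose compose_eq)
  have "auto G \<subseteq> carrier G \<rightarrow>\<^sub>E carrier G"
    by (auto simp: auto_def Bij_def hom_def PiE_def)
  then have "finite (auto G)" using assms by (meson finite_PiE finite_subset)
  then show "finite {T \<in> auto G. T x = z}" by simp
qed

text \<open>Automorphisms preserve element orders, so this fails for instance in the cyclic group of
  order 4. This is the reason for passing from \<open>A\<close> to an elementary abelian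
  group.\<close>

definition auto_transitive :: "('a, 'm) monoid_scheme \<Rightarrow> bool" where
  "auto_transitive G \<longleftrightarrow>
     (\<forall>x\<in>carrier G - {\<one>\<^bsub>G\<^esub>}. \<forall>y\<in>carrier G - {\<one>\<^bsub>G\<^esub>}. \<exists>T\<in>auto G. T x = y)"

text \<open>
  Union bound: by transitivity, a random automorphism sends a given non-neutral element to each
  of the \<open>q - 1\<close> non-neutral elements with the same probability \<open>1 / (q - 1)\<close>.
\<close>

lemma (in group) exists_auto_avoiding:
  assumes fin: "finite (carrier G)" and tr: "auto_transitive G"
    and C: "finite C" "card C + 2 \<le> order G"
    and a: "a \<in> C \<rightarrow> carrier G - {\<one>}" and b: "b \<in> C \<rightarrow> carrier G - {\<one>}"
  shows "\<exists>T\<in>auto G. \<forall>e\<in>C. T (a e) \<noteq> b e"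
proof (rule ccontr)
  assume "\<not> ?thesis"
  then have cover: "auto G \<subseteq> (\<Union>e\<in>C. {T \<in> auto G. T (a e) = b e})" by blast
  have "auto G \<subseteq> carrier G \<rightarrow>\<^sub>E carrier G"
    by (auto simp: auto_def Bij_def hom_def PiE_def)
  then have fin_auto: "finite (auto G)" using fin by (meson finite_PiE finite_subset)
  let ?X = "carrier G - {\<one>}"
  have card_X: "card ?X = order G - 1" using fin by (simp add: order_def)
  have fibre: "card ?X * card {T \<in> auto G. T x = y} = card (auto G)" if "x \<in> ?X" "y \<in> ?X" for x y
  proof -
    have eq: "card {T \<in> auto G. T x = z} = card {T \<in> auto G. T x = y}" if z: "z \<in> ?X" for z
    proof -
      \<comment> \<open>Automorphisms in both directions between \<open>y\<close> and
        \<open>z\<close> give the two inequalities between the fibres.\<close>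
      obtain U V where "U \<in> auto G" "U z = y" "V \<in> auto G" "V y = z"
        using tr \<open>y \<in> ?X\<close> z unfolding auto_transitive_def by meson
      then show ?thesis
        using \<open>x \<in> ?X\<close> fin
        by (intro order_antisym card_auto_mapping_le[of V] card_auto_mapping_le[of U]) auto
    qed
    have "T x \<in> ?X" if "T \<in> auto G" for T
    proof -
      have "T x \<in> carrier G" using that \<open>x \<in> ?X\<close> by (auto simp: auto_def hom_def)
      moreover have "T \<one> = \<one>" using that by (auto simp: auto_def intro: hom_one is_group)
      then have "T x \<noteq> \<one>" using that \<open>x \<in> ?X\<close>
        by (auto simp: auto_def Bij_def bij_betw_def inj_on_def)
      ultimately show ?thesis by simp
    qed
    then have "auto G = (\<Union>z\<in>?X. {T \<in> auto G. T x = z})" by auto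
    also have "card \<dots> = (\<Sum>z\<in>?X. card {T \<in> auto G. T x = z})"
      using fin fin_auto by (intro card_UN_disjoint) auto
    also have "\<dots> = card ?X * card {T \<in> auto G. T x = y}"
      using eq by simp
    finally show ?thesis by simp
  qed
  have "card (auto G) \<le> card (\<Union>e\<in>C. {T \<in> auto G. T (a e) = b e})"
    using cover fin_auto C by (intro card_mono) auto
  also have "\<dots> \<le> (\<Sum>e\<in>C. card {T \<in> auto G. T (a e) = b e})"
    using C by (intro card_UN_le)
  \<comment> \<open>Multiplying by \<open>card ?X\<close> avoids division: each summand on the right
    then equals \<open>card (auto G)\<close>.\<close>
  finally have "card ?X * card (auto G) \<le> card ?X * (\<Sum>e\<in>C. card {T \<in> auto G. T (a e) = b e})"
    by simp
  also have "\<dots> = (\<Sum>e\<in>C. card (auto G))"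
    unfolding sum_distrib_left using a b by (intro sum.cong refl fibre) (rule funcset_mem, assumption+)+
  also have "\<dots> = card C * card (auto G)" by simp
  finally have "card ?X * card (auto G) \<le> card C * card (auto G)" .
  moreover have "card (auto G) > 0" using fin_auto id_in_auto by (auto simp: card_gt_0_iff)
  ultimately have "order G - 1 \<le> card C" unfolding card_X by (simp only: mult_le_cancel2)
  then show False using C by linarith
qed

text \<open>An automorphism preserves conservation and non-neutral values, so it may be applied to
  one flow before the two are multiplied. Only on common edges are both factors non-neutral, so only
  there must cancellation be avoided.\<close>

lemma (in comm_group) nz_flows_union:
  assumes fin: "finite (carrier G)" and tr: "auto_transitive G"
    and E: "finite E" "finite F" "card (E \<inter> F) + 2 \<le> order G"
    and "nz_flows G t h E \<noteq> {}" "nz_flows G t h F \<noteq> {}"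
  shows "nz_flows G t h (E \<union> F) \<noteq> {}"
proof -
  obtain f g where f: "f \<in> E \<rightarrow>\<^sub>E carrier G - {\<one>}" "conserved G t h E f"
    and g: "g \<in> F \<rightarrow>\<^sub>E carrier G - {\<one>}" "conserved G t h F g"
    using assms by (auto simp: nz_flows_def)
  \<comment> \<open>On a common edge the product is neutral exactly when
    \<open>T (g e) = inv (f e)\<close>; these inverses are the values to be avoided.\<close>
  have "(\<lambda>e. inv (f e)) \<in> E \<inter> F \<rightarrow> carrier G - {\<one>}"
    using f by (auto simp: inv_eq_1_iff Pi_iff PiE_iff)
  then obtain T where T: "T \<in> auto G" and avoid: "\<And>e. e \<in> E \<inter> F \<Longrightarrow> T (g e) \<noteq> inv (f e)"
    using exists_auto_avoiding[OF fin tr, of "E \<inter> F" g "\<lambda>e. inv (f e)"] E g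
    by (auto simp: PiE_iff Pi_iff)
  have hom: "T \<in> hom G G" and inj: "inj_on T (carrier G)"
    using T by (auto simp: auto_def Bij_def bij_betw_def)
  have T1: "T \<one> = \<one>" using hom by (rule hom_one) (rule is_group)+
  let ?f = "\<lambda>e. if e \<in> E then f e else \<one>" and ?g = "\<lambda>e. if e \<in> F then T (g e) else \<one>"
  have fE: "f \<in> E \<rightarrow> carrier G" using f by auto
  have gF: "g \<in> F \<rightarrow> carrier G" using g by auto
  have TgF: "(\<lambda>e. T (g e)) \<in> F \<rightarrow> carrier G" using gF hom by (auto simp: hom_def)
  have Tg: "T (g e) \<noteq> \<one>" if "e \<in> F" for e
    using that g inj T1 by (metis DiffD1 DiffD2 PiE_mem inj_onD insertI1 one_closed)
  have cf: "conserved G t h (E \<union> F) ?f"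
    using conserved_extend[OF _ _ fE f(2), of "E \<union> F"] E by simp
  have cg: "conserved G t h (E \<union> F) ?g"
    using E by (intro conserved_extend[OF Un_upper2 _ TgF conserved_hom[OF hom gF g(2) E(2)]]) simp
  have cl: "?f \<in> E \<union> F \<rightarrow> carrier G" "?g \<in> E \<union> F \<rightarrow> carrier G" using fE TgF by auto
  have "conserved G t h (E \<union> F) (\<lambda>e\<in>E \<union> F. ?f e \<otimes> ?g e)"
  proof (rule conserved_cong[THEN iffD2, OF _ _ conserved_mult[OF cl cf cg]])
    show "(\<lambda>e. ?f e \<otimes> ?g e) \<in> E \<union> F \<rightarrow> carrier G"
      by (intro funcsetI m_closed funcset_mem[OF cl(1)] funcset_mem[OF cl(2)])
  qed simp
  moreover have "(\<lambda>e\<in>E \<union> F. ?f e \<otimes> ?g e) \<in> E \<union> F \<rightarrow>\<^sub>E carrier G - {\<one>}"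
  proof (rule restrict_PiE_iff[THEN iffD2], intro ballI DiffI)
    fix e assume e: "e \<in> E \<union> F"
    then have c: "?f e \<in> carrier G" "?g e \<in> carrier G"
      by (fact funcset_mem[OF cl(1)] funcset_mem[OF cl(2)])+
    then show "?f e \<otimes> ?g e \<in> carrier G" by (rule m_closed)
    have "?f e \<otimes> ?g e \<noteq> \<one>"
    proof (cases "e \<in> E \<inter> F")
      case True
      then have "f e \<in> carrier G" "T (g e) \<in> carrier G" using c by auto
      with avoid[OF True] have "f e \<otimes> T (g e) \<noteq> \<one>" by (metis inv_equality m_comm)
      then show ?thesis using True by simp
    next
      case False
      then show ?thesis using e f c Tg by (auto simp: PiE_iff)
    qed
    then show "?f e \<otimes> ?g e \<notin> {\<one>}" by simp
  qed
  ultimately show ?thesis unfolding nz_flows_def by blast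
qed

section \<open>Elementary abelian groups\<close>

lemma comm_group_product_group:
  assumes "\<And>i. i \<in> I \<Longrightarrow> comm_group (G i)"
  shows "comm_group (product_group I G)"
proof -
  interpret group "product_group I G"
    using assms by (intro product_group) (simp add: comm_group_def)
  show ?thesis
    by (rule group_comm_groupI)
      (auto intro!: restrict_ext comm_monoid.m_comm comm_group.axioms(1)[OF assms])
qed

lemma order_product_integer_mod_group:
  "p > 0 \<Longrightarrow> order (product_group {..<n} (\<lambda>_. integer_mod_group p)) = p ^ n"
  by (simp add: order_def card_PiE carrier_integer_mod_group)

text \<open>
  The transvection \<open>v \<mapsto> v + g(v) (y - x)\<close> with \<open>g(x) = 1\<close> maps \<open>x\<close> to \<open>y\<close>, and it is
  injective as soon as the linear form \<open>g\<close> does not vanish at \<open>y\<close>. At most two coordinates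
  are needed to find such a \<open>g\<close>.
\<close>

lemma auto_transitive_product_integer_mod_group:
  fixes n :: nat
  assumes p: "Factorial_Ring.prime p"
  shows "auto_transitive (product_group {..<n} (\<lambda>_. integer_mod_group p))"
    (is "auto_transitive ?B")
  unfolding auto_transitive_def
proof (intro ballI)
  fix x y assume x: "x \<in> carrier ?B - {\<one>\<^bsub>?B\<^esub>}" and y: "y \<in> carrier ?B - {\<one>\<^bsub>?B\<^esub>}"
  define P where "P = int p"
  have P: "Factorial_Ring.prime P" "P > 1" using p prime_gt_1_nat[OF p] by (simp_all add: P_def)
  have carr: "carrier ?B = {..<n} \<rightarrow>\<^sub>E {0..<P}"
    using p P by (auto simp: P_def carrier_integer_mod_group)
  have coord: "0 \<le> z i" "z i < P" if "z \<in> carrier ?B" "i < n" for z i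
    using PiE_mem[OF that(1)[unfolded carr], of i] that(2) by simp_all
  have nz: "\<exists>i<n. \<not> P dvd z i" if "z \<in> carrier ?B - {\<one>\<^bsub>?B\<^esub>}" for z
  proof (rule ccontr)
    assume *: "\<not> ?thesis"
    have z: "z \<in> {..<n} \<rightarrow>\<^sub>E {0..<P}" using that carr by blast
    have "z i = 0" if "i < n" for i
    proof -
      have "0 \<le> z i" "z i < P" using PiE_mem[OF z, of i] that by simp_all
      then show ?thesis using * that zdvd_not_zless[of "z i" P] by force
    qed
    then have "z = \<one>\<^bsub>?B\<^esub>" using z by (auto simp: PiE_iff extensional_def)
    then show False using that by simp
  qed
  have inverse: "\<exists>c. P dvd c * a - 1" if "\<not> P dvd a" for a
  proof -
    have "coprime a P" using prime_imp_coprime[OF P(1) that] by (simp add: coprime_commute)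
    then obtain u v where "u * a + v * P = 1" by (metis bezout_int coprime_imp_gcd_eq_1)
    then have "u * a - 1 = - v * P" by simp
    then show ?thesis by (metis dvd_triv_right)
  qed
  obtain c d i j where ij: "i < n" "j < n" and gx: "P dvd c * x i + d * x j - 1"
    and gy: "\<not> P dvd c * y i + d * y j"
  proof (cases "\<exists>i<n. \<not> P dvd x i \<and> \<not> P dvd y i")
    \<comment> \<open>Where neither \<open>x\<close> nor \<open>y\<close> vanishes, one coordinate
      suffices: \<open>j = i\<close>, \<open>d = 0\<close>, and \<open>c\<close> inverts
      \<open>x i\<close> modulo \<open>P\<close>.\<close>
    case True
    then obtain i c where i: "i < n" "\<not> P dvd x i" "\<not> P dvd y i" and c: "P dvd c * x i - 1"
      using inverse by metis
    have "\<not> P dvd c"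
    proof
      assume "P dvd c"
      then have "P dvd c * x i - (c * x i - 1)" by (rule dvd_diff[OF dvd_mult2 c])
      then show False using P by (simp add: zdvd1_eq)
    qed
    then have "\<not> P dvd c * y i" using i P by (simp add: prime_dvd_mult_iff)
    then show thesis using that[of i i c 0] i c by simp
  next
    case False
    \<comment> \<open>Now \<open>y\<close> vanishes at \<open>i\<close> and \<open>x\<close> at
      \<open>j\<close> modulo \<open>P\<close>, so the two conditions decouple: \<open>c\<close>
      alone normalises the form at \<open>x\<close>, and \<open>d\<close> alone keeps it nonzero at
      \<open>y\<close>.\<close>
    obtain i j where i: "i < n" "\<not> P dvd x i" and j: "j < n" "\<not> P dvd y j"
      using nz[OF x] nz[OF y] by auto
    then have 0: "P dvd y i" "P dvd x j" using False by auto
    obtain c d where c: "P dvd c * x i - 1" and d: "P dvd d * y j - 1"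
      using inverse i j by metis
    have "P dvd (c * x i - 1) + d * x j" using c 0 by (intro dvd_add) auto
    then have "P dvd c * x i + d * x j - 1" by (simp add: algebra_simps)
    moreover have "\<not> P dvd c * y i + d * y j"
    proof
      assume "P dvd c * y i + d * y j"
      then have "P dvd (c * y i + d * y j) - c * y i - (d * y j - 1)"
        by (rule dvd_diff[OF dvd_diff[OF _ dvd_mult[OF 0(1)]] d])
      then show False using P by (simp add: zdvd1_eq)
    qed
    ultimately show thesis using that i j by blast
  qed
  define g where "g v = c * v i + d * v j" for v :: "nat \<Rightarrow> int"
  \<comment> \<open>The inner restriction puts each value into the extensional carrier of
    \<open>?B\<close>; the outer one makes \<open>T\<close> extensional, as \<open>Bij\<close>
    demands.\<close>
  define T where "T = (\<lambda>v\<in>carrier ?B. \<lambda>k\<in>{..<n}. (v k + g v * (y k - x k)) mod P)"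
  have T_in: "T v \<in> carrier ?B" if "v \<in> carrier ?B" for v
  proof -
    have "(\<lambda>k\<in>{..<n}. (v k + g v * (y k - x k)) mod P) \<in> carrier ?B"
      unfolding carr restrict_PiE_iff using P(2) by simp
    then show ?thesis unfolding T_def by (subst restrict_apply'[OF that])
  qed
  have T_eq: "T v k = (v k + g v * (y k - x k)) mod P" if "v \<in> carrier ?B" "k < n" for v k
    using that by (simp add: T_def)
  have "T \<in> hom ?B ?B"
  proof (rule homI)
    fix v w assume v: "v \<in> carrier ?B" and w: "w \<in> carrier ?B"
    interpret B: comm_group ?B by (intro comm_group_product_group) simp
    have vw: "v \<otimes>\<^bsub>?B\<^esub> w \<in> carrier ?B" using v w by (rule B.m_closed)
    have eq: "(v \<otimes>\<^bsub>?B\<^esub> w) k = (v k + w k) mod P" if "k < n" for k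
      using that by (simp add: P_def)
    have "T (v \<otimes>\<^bsub>?B\<^esub> w) k = (T v k + T w k) mod P" if k: "k < n" for k
    proof -
      have "T (v \<otimes>\<^bsub>?B\<^esub> w) k = ((v k + w k) mod P
          + (c * ((v i + w i) mod P) + d * ((v j + w j) mod P)) * (y k - x k)) mod P"
        unfolding T_eq[OF vw k] g_def eq[OF ij(1)] eq[OF ij(2)] eq[OF k] ..
      also have "\<dots> = (v k + w k + (c * (v i + w i) + d * (v j + w j)) * (y k - x k)) mod P"
        by (rule mod_add_cong mod_mult_cong mod_mod_trivial refl)+
      also have "\<dots> = ((v k + g v * (y k - x k)) + (w k + g w * (y k - x k))) mod P"
        by (simp add: g_def algebra_simps)
      also have "\<dots> = (T v k + T w k) mod P"
        unfolding T_eq[OF v k] T_eq[OF w k] by (simp only: mod_add_eq)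
      finally show ?thesis .
    qed
    moreover have "(T v \<otimes>\<^bsub>?B\<^esub> T w) k = (T v k + T w k) mod P" if "k < n" for k
      using that by (simp add: P_def)
    ultimately have "T (v \<otimes>\<^bsub>?B\<^esub> w) k = (T v \<otimes>\<^bsub>?B\<^esub> T w) k" if "k \<in> {..<n}" for k
      using that by (metis lessThan_iff)
    then show "T (v \<otimes>\<^bsub>?B\<^esub> w) = T v \<otimes>\<^bsub>?B\<^esub> T w"
      by (rule PiE_ext[OF T_in[OF vw, unfolded carr]
            B.m_closed[OF T_in[OF v] T_in[OF w], unfolded carr]])
  qed (rule T_in)
  moreover have "T \<in> Bij (carrier ?B)"
  proof -
    have "inj_on T (carrier ?B)"
    proof (rule inj_onI)
      fix v w assume v: "v \<in> carrier ?B" and w: "w \<in> carrier ?B" and eq: "T v = T w"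
      have k: "P dvd (v k - w k) + (g v - g w) * (y k - x k)" if "k < n" for k
      proof -
        have "P dvd (v k + g v * (y k - x k)) - (w k + g w * (y k - x k))"
          using eq T_eq[OF v that] T_eq[OF w that] by (metis mod_eq_dvd_iff)
        then show ?thesis by (simp add: algebra_simps)
      qed
      \<comment> \<open>Applying the linear form to the congruences \<open>k\<close> yields
        \<open>g v - g w\<close> times \<open>1 + g y - g x\<close>. Since \<open>g x\<close> is 1
        modulo \<open>P\<close>, the second factor is congruent to \<open>g y\<close> and so is not
        divisible by \<open>P\<close>.\<close>
      have "P dvd c * ((v i - w i) + (g v - g w) * (y i - x i))
          + d * ((v j - w j) + (g v - g w) * (y j - x j))"
        by (rule dvd_add[OF dvd_mult[OF k[OF ij(1)]] dvd_mult[OF k[OF ij(2)]]])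
      also have "\<dots> = (g v - g w) * (g y - (g x - 1))"
        by (simp add: g_def algebra_simps)
      finally have "P dvd g v - g w \<or> P dvd g y - (g x - 1)"
        using P by (simp add: prime_dvd_mult_iff)
      moreover have "\<not> P dvd g y - (g x - 1)"
      proof
        assume "P dvd g y - (g x - 1)"
        then have "P dvd (g y - (g x - 1)) + (g x - 1)" using gx unfolding g_def by (rule dvd_add)
        then show False using gy by (simp add: g_def)
      qed
      ultimately have g: "P dvd g v - g w" by simp
      have "v k = w k" if "k < n" for k
      proof -
        have "P dvd ((v k - w k) + (g v - g w) * (y k - x k)) - (g v - g w) * (y k - x k)"
          by (rule dvd_diff[OF k[OF that] dvd_mult2[OF g]])
        then have "v k mod P = w k mod P" by (simp add: mod_eq_dvd_iff)
        then show ?thesis using coord[OF v that] coord[OF w that] by simp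
      qed
      then show "v = w" by (intro PiE_ext[OF v[unfolded carr] w[unfolded carr]]) simp
    qed
    moreover have "finite (carrier ?B)" unfolding carr by (intro finite_PiE) auto
    ultimately have "bij_betw T (carrier ?B) (carrier ?B)"
      using T_in by (simp add: bij_betw_def endo_inj_surj image_subsetI)
    then show ?thesis by (simp add: Bij_def T_def)
  qed
  moreover have "T x = y"
  proof -
    have xB: "x \<in> carrier ?B" and yB: "y \<in> carrier ?B" using x y by auto
    have "T x k = y k" if "k < n" for k
    proof -
      have "P dvd (g x - 1) * (y k - x k)" using gx unfolding g_def by (rule dvd_mult2)
      then have "P dvd (x k + g x * (y k - x k)) - y k" by (simp add: algebra_simps)
      then have "T x k = y k mod P" using T_eq[OF xB that] by (simp add: mod_eq_dvd_iff)
      then show ?thesis using coord[OF yB that] by simp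
    qed
    then show ?thesis
      by (intro PiE_ext[OF T_in[OF xB, unfolded carr] yB[unfolded carr]]) simp
  qed
  ultimately show "\<exists>T\<in>auto ?B. T x = y" by (auto simp: auto_def)
qed

section \<open>Adding the subgraphs one at a time\<close>

theorem theorem3p5:
  fixes \<Gamma> :: "('v, 'e) mgraph"
    and H :: "nat \<Rightarrow> ('v, 'e) mgraph"
    and A :: "('a, 'm) monoid_scheme"
    and p n s :: nat
  assumes "finite_mgraph \<Gamma>" and "loopless_mgraph \<Gamma>"
    and "comm_group A" and "Factorial_Ring.prime p" and "n \<ge> 1" and "order A = p ^ n"
    and "s \<ge> 2"
    and "\<And>i. i \<in> {1..s} \<Longrightarrow> is_subgraph (H i) \<Gamma>"
    and "\<Gamma> = subgraph_Union \<Gamma> {1..s} H"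
    and "\<And>i. i \<in> {1..s} \<Longrightarrow> admits_nowhere_zero_flow A (H i)"
    and "\<And>l. l \<in> {2..s} \<Longrightarrow>
           int (card (medges (subgraph_Union \<Gamma> {1..l - 1} H) \<inter> medges (H l))) \<le> int (p ^ n) - 2"
  shows "admits_nowhere_zero_flow A \<Gamma>"
proof -
  let ?B = "product_group {..<n} (\<lambda>_. integer_mod_group p)"
  interpret A: comm_group A by fact
  interpret B: comm_group ?B by (intro comm_group_product_group) simp
  have p: "p > 0" using assms(4) prime_gt_0_nat by blast
  have order_B: "order ?B = p ^ n" using p by (rule order_product_integer_mod_group)
  have fin: "finite (carrier A)" "finite (carrier ?B)"
    using p assms(6) order_B by (auto simp: order_def intro: card_ge_0_finite)
  \<comment> \<open>One reference orientation of \<open>\<Gamma>\<close> is fixed; it orients every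
    subgraph consistently, so that their flows can be multiplied edge by edge.\<close>
  have "\<exists>t h. \<forall>e\<in>medges \<Gamma>. {t e, h e} = ends \<Gamma> e"
  proof -
    have "\<exists>a b. {a, b} = ends \<Gamma> e" if "e \<in> medges \<Gamma>" for e
      using assms(2) that unfolding loopless_mgraph_def card_2_iff by metis
    then show ?thesis by metis
  qed
  then obtain t h where th: "\<And>e. e \<in> medges \<Gamma> \<Longrightarrow> {t e, h e} = ends \<Gamma> e" by blast
  have finite_\<Gamma>: "finite (medges \<Gamma>)" using assms(1) by (simp add: finite_mgraph_def)
  \<comment> \<open>Equal finite counts are both zero or both nonzero. This carries the flows of
    each \<open>H i\<close> from \<open>A\<close> to \<open>?B\<close>, and at the end the flow of
    \<open>\<Gamma>\<close> back to \<open>A\<close>.\<close>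
  have transfer: "nz_flows A t h E \<noteq> {} \<longleftrightarrow> nz_flows ?B t h E \<noteq> {}" if "finite E" for E
    using card_nz_flows_eq[OF assms(3) B.comm_group_axioms fin _ that, of t h] order_B assms(6)
      A.finite_nz_flows[OF that fin(1), of t h] B.finite_nz_flows[OF that fin(2), of t h]
    by (metis card_eq_0_iff)
  have H: "finite (medges (H i))" "nz_flows ?B t h (medges (H i)) \<noteq> {}" if "i \<in> {1..s}" for i
  proof -
    have sub: "loopless_mgraph (H i)" "medges (H i) \<subseteq> medges \<Gamma>"
      "\<And>e. e \<in> medges (H i) \<Longrightarrow> ends (H i) e = ends \<Gamma> e"
      using assms(8)[OF that] by (auto simp: is_subgraph_def)
    show finite_H: "finite (medges (H i))" using sub(2) finite_\<Gamma> by (rule finite_subset)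
    have "{t e, h e} = ends (H i) e" if "e \<in> medges (H i)" for e
      using th[of e] sub(2,3) that by auto
    then show "nz_flows ?B t h (medges (H i)) \<noteq> {}"
      using assms(10)[OF that] A.admits_nowhere_zero_flow_iff[OF sub(1) finite_H] transfer[OF finite_H]
      by blast
  qed
  have "nz_flows ?B t h (\<Union>i\<in>{1..l}. medges (H i)) \<noteq> {}" if "1 \<le> l" "l \<le> s" for l
    using that
  proof (induction l rule: dec_induct)
    case base
    then show ?case using H[of 1] by simp
  next
    case (step l)
    let ?E = "\<Union>i\<in>{1..l}. medges (H i)"
    \<comment> \<open>The hypothesis at \<open>Suc l\<close> concerns the union up to
      \<open>Suc l - 1 = l\<close>. Its integer bound is not truncated, so it yields the form
      \<open>card + 2 \<le> order\<close> over the naturals.\<close>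
    have "int (card (?E \<inter> medges (H (Suc l)))) \<le> int (p ^ n) - 2"
      using assms(11)[of "Suc l"] step by (simp add: subgraph_Union_def)
    then have "card (?E \<inter> medges (H (Suc l))) + 2 \<le> order ?B"
      unfolding order_B by linarith
    then have "nz_flows ?B t h (?E \<union> medges (H (Suc l))) \<noteq> {}"
      using step H fin(2) assms(4)
      by (intro B.nz_flows_union auto_transitive_product_integer_mod_group finite_UN_I) auto
    then show ?case using step by (simp add: atLeastAtMostSuc_conv Un_commute)
  qed
  then have "nz_flows ?B t h (\<Union>i\<in>{1..s}. medges (H i)) \<noteq> {}" using assms(7) by simp
  moreover have "medges \<Gamma> = (\<Union>i\<in>{1..s}. medges (H i))"
    using arg_cong[OF assms(9), of medges] by (simp add: subgraph_Union_def)
  ultimately show ?thesis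
    using A.admits_nowhere_zero_flow_iff[OF assms(2) finite_\<Gamma> th] transfer[OF finite_\<Gamma>] by simp
qed

end
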